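(* Given a core facet $\beta_0+\sum_{j=1}^n\beta_jx_j+\beta' y\ge 0$, let $$r=\min\{k\in\{0,\dots,n-1\}:\mathcal{L}_k(\beta_0,\beta)+\beta' m(x^k)=0\},\qquad s=\max\{k\in\{1,\dots,n\}:\mathcal{L}_k(\beta_0,\beta)+\beta' m(x^k)=0\}.$$ Then $\beta_1=\cdots=\beta_{r+1}$ and $\beta_s=\cdots=\beta_n$.
   Context: Let $n\ge 2$, $N=\{1,\dots,n\}$, and let $\ell<u$ be real numbers. Let $X=\{x\in\mathbb{R}^n:\ell\le x_j\le u,\ j\in N\}$. For real coefficients $c_2,\dots,c_n$, not all zero, let $m(x)=\sum_{i=2}^n c_i\sum_{J\subseteq N,\ |J|=i}\prod_{j\in J}x_j$, and let $G=\{(x,y)\in\mathbb{R}^n\times\mathbb{R}: x\in X,\ y=m(x)\}$. The set $\operatorname{conv}(G)$ is a polytope of dimension $n+1$. For $k=0,\dots,n$, $x^k\in\mathbb{R}^n$ has its first $k$ entries equal to $u$ and its last $n-k$ entries equal to $\ell$. A core inequality is a linear inequality $\beta_0+\sum_{j=1}^n\beta_jx_j+\beta' y\ge 0$ with $\beta'\in\{-1,1\}$ and $\beta_1\le\cdots\le\beta_n$; it is a core facet if it is valid for $\operatorname{conv}(G)$ (satisfied by all its points) and the set of points of $\operatorname{conv}(G)$ satisfying it with equality is a facet of $\operatorname{conv}(G)$. For $k\in\{0,\dots,n\}$, $\mathcal{L}_k(\beta_0,\beta)=\beta_0+u\sum_{j=1}^k\beta_j+\ell\sum_{j=k+1}^n\beta_j$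 (empty sums are $0$). (A core facet is always satisfied with equality at $(x^k,m(x^k))$ for at least two values of $k$, so $r$ and $s$ are well defined.) *)

theory Defs
  imports "HOL-Analysis.Analysis"
begin

(* R^n is real ^ 'n with n = CARD('n).  The coordinates are numbered 1, ..., n by an
   enumeration e (a bijection from {1..n} onto 'n), so the paper's x_j is x $ e j.
   Coefficients c, beta are sequences read only at the indices in question. *)

definition box_X :: "(nat \<Rightarrow> 'n::finite) \<Rightarrow> real \<Rightarrow> real \<Rightarrow> (real ^ 'n) set" where
  "box_X e l u = {x. \<forall>j\<in>{1..CARD('n)}. l \<le> x $ e j \<and> x $ e j \<le> u}"

definition multilin :: "(nat \<Rightarrow> 'n::finite) \<Rightarrow> (nat \<Rightarrow> real) \<Rightarrow> real ^ 'n \<Rightarrow> real" where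
  "multilin e c x =
     (\<Sum>i=2..CARD('n). c i * (\<Sum>J | J \<subseteq> {1..CARD('n)} \<and> card J = i. \<Prod>j\<in>J. x $ e j))"

definition graph_G ::
  "(nat \<Rightarrow> 'n::finite) \<Rightarrow> real \<Rightarrow> real \<Rightarrow> (nat \<Rightarrow> real) \<Rightarrow> ((real ^ 'n) \<times> real) set" where
  "graph_G e l u c = {(x, y). x \<in> box_X e l u \<and> y = multilin e c x}"

definition point_x :: "(nat \<Rightarrow> 'n::finite) \<Rightarrow> real \<Rightarrow> real \<Rightarrow> nat \<Rightarrow> real ^ 'n" where
  "point_x e l u k = (\<chi> i. if i \<in> e ` {1..k} then u else l)"

definition ineq_lhs ::
  "(nat \<Rightarrow> 'n::finite) \<Rightarrow> real \<Rightarrow> (nat \<Rightarrow> real) \<Rightarrow> real \<Rightarrow> real ^ 'n \<Rightarrow> real \<Rightarrow> real" where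
  "ineq_lhs e \<beta>0 \<beta> \<beta>' x y = \<beta>0 + (\<Sum>j=1..CARD('n). \<beta> j * x $ e j) + \<beta>' * y"

definition core_inequality :: "nat \<Rightarrow> (nat \<Rightarrow> real) \<Rightarrow> real \<Rightarrow> bool" where
  "core_inequality n \<beta> \<beta>' \<longleftrightarrow> \<beta>' \<in> {-1, 1} \<and> (\<forall>j\<in>{1..<n}. \<beta> j \<le> \<beta> (j + 1))"

definition core_facet ::
  "(nat \<Rightarrow> 'n::finite) \<Rightarrow> real \<Rightarrow> real \<Rightarrow> (nat \<Rightarrow> real) \<Rightarrow> real \<Rightarrow> (nat \<Rightarrow> real) \<Rightarrow> real \<Rightarrow> bool" where
  "core_facet e l u c \<beta>0 \<beta> \<beta>' \<longleftrightarrow>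
     core_inequality CARD('n) \<beta> \<beta>' \<and>
     (\<forall>(x, y) \<in> convex hull (graph_G e l u c). ineq_lhs e \<beta>0 \<beta> \<beta>' x y \<ge> 0) \<and>
     {(x, y) \<in> convex hull (graph_G e l u c). ineq_lhs e \<beta>0 \<beta> \<beta>' x y = 0}
       facet_of (convex hull (graph_G e l u c))"

definition Lk :: "nat \<Rightarrow> real \<Rightarrow> real \<Rightarrow> nat \<Rightarrow> real \<Rightarrow> (nat \<Rightarrow> real) \<Rightarrow> real" where
  "Lk n l u k \<beta>0 \<beta> = \<beta>0 + u * (\<Sum>j=1..k. \<beta> j) + l * (\<Sum>j=k+1..n. \<beta> j)"

end

theory Submission
  imports Defs
begin

text \<open>
  Write \<open>h\<close> for the left-hand side of the core facet.  On the graph of \<open>m\<close> it is a function of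
  \<open>x\<close> that is affine in every single coordinate, and at a vertex of the box with set \<open>S\<close> of
  coordinates equal to \<open>u\<close> the value of \<open>m\<close> depends on the size of \<open>S\<close> only.

  The polytope \<open>conv G\<close> has full dimension \<open>n + 1\<close>: on the diagonal of the box \<open>m\<close> is a nonzero
  polynomial in one variable whose terms all have degree at least two, so the graph lies in no hyperplane
  (lemma \<open>aff_dim_graph_hull\<close>).  Hence the affine hull of a facet is a hyperplane, here
  \<open>h = 0\<close>, which is not vertical since \<open>\<beta>' \<noteq> 0\<close>.  A facet is therefore contained in none of the
  vertical hyperplanes \<open>x\<^sub>j = d\<close>.  As it is the hull of its points of the graph, one of these
  points lies off this hyperplane.  Rounding the coordinates of this point one at a time, which keeps \<open>h = 0\<close> because a nonnegative
  affine function with an interior zero vanishes, leads to a tight vertex off the hyperplane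
  (lemma \<open>core_facet_tight_vertex\<close>).

  Taking \<open>x\<^sub>1 = u\<close> for this hyperplane gives a tight vertex with set \<open>S\<close> not containing \<open>1\<close>.  As
  \<open>\<beta>\<close> is nondecreasing, the vertex \<open>x\<^sup>k\<close> with \<open>k = card S\<close> is tight as well, so \<open>r \<le> card S\<close>.
  If \<open>r = 0\<close>, nothing is claimed; otherwise \<open>S\<close>, which misses \<open>1\<close>, has an element \<open>b > r\<close>.  Replacing \<open>b\<close> by \<open>1\<close> in \<open>S\<close> changes
  \<open>h\<close> by a positive multiple of \<open>\<beta>\<^sub>1 - \<beta>\<^sub>b \<le> 0\<close>; as \<open>h\<close> cannot become negative,
  \<open>\<beta>\<^sub>1 = \<beta>\<^sub>b\<close>, and monotonicity makes all coefficients in between equal.  The claim on \<open>s\<close> follows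
  in the same way from a tight vertex off \<open>x\<^sub>n = l\<close>.
\<close>

section \<open>Rounding zeros of coordinatewise affine functions\<close>

definition coordinatewise_affine :: "(real ^ 'n \<Rightarrow> real) \<Rightarrow> bool" where
  "coordinatewise_affine g \<longleftrightarrow>
     (\<forall>x i. \<exists>a b. \<forall>t. g (\<chi> j. if j = i then t else x $ j) = a + b * t)"

lemma coordinatewise_affine_const: "coordinatewise_affine (\<lambda>x. a)"
  unfolding coordinatewise_affine_def by (metis add.right_neutral mult_zero_left)

lemma coordinatewise_affine_add:
  fixes f :: "real ^ 'n::finite \<Rightarrow> real"
  assumes "coordinatewise_affine f" "coordinatewise_affine g"
  shows "coordinatewise_affine (\<lambda>x. f x + g x)"
  unfolding coordinatewise_affine_def
proof (intro allI)
  fix x :: "real ^ 'n" and i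
  obtain a b where "\<forall>t. f (\<chi> j. if j = i then t else x $ j) = a + b * t"
    using assms(1) unfolding coordinatewise_affine_def by meson
  moreover obtain c d where "\<forall>t. g (\<chi> j. if j = i then t else x $ j) = c + d * t"
    using assms(2) unfolding coordinatewise_affine_def by meson
  ultimately have "\<forall>t. f (\<chi> j. if j = i then t else x $ j) + g (\<chi> j. if j = i then t else x $ j)
      = (a + c) + (b + d) * t"
    by (simp add: algebra_simps)
  then show "\<exists>a b. \<forall>t. f (\<chi> j. if j = i then t else x $ j)
      + g (\<chi> j. if j = i then t else x $ j) = a + b * t"
    by blast
qed

lemma coordinatewise_affine_scale:
  fixes f :: "real ^ 'n::finite \<Rightarrow> real"
  assumes "coordinatewise_affine f"
  shows "coordinatewise_affine (\<lambda>x. a * f x)"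
  unfolding coordinatewise_affine_def
proof (intro allI)
  fix x :: "real ^ 'n" and i
  obtain c d where "\<forall>t. f (\<chi> j. if j = i then t else x $ j) = c + d * t"
    using assms unfolding coordinatewise_affine_def by meson
  then have "\<forall>t. a * f (\<chi> j. if j = i then t else x $ j) = a * c + (a * d) * t"
    by (simp add: algebra_simps)
  then show "\<exists>c d. \<forall>t. a * f (\<chi> j. if j = i then t else x $ j) = c + d * t"
    by blast
qed

lemma coordinatewise_affine_sum:
  assumes "\<And>k. k \<in> A \<Longrightarrow> coordinatewise_affine (f k)"
  shows "coordinatewise_affine (\<lambda>x. \<Sum>k\<in>A. f k x)"
  using assms
  by (induction A rule: infinite_finite_induct)
    (auto simp: coordinatewise_affine_const coordinatewise_affine_add)

lemma coordinatewise_affine_monomial: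
  fixes e :: "'b \<Rightarrow> 'n::finite"
  assumes "inj_on e J" "finite J"
  shows "coordinatewise_affine (\<lambda>x. \<Prod>j\<in>J. x $ e j)"
  unfolding coordinatewise_affine_def
proof (intro allI)
  fix x :: "real ^ 'n" and i
  show "\<exists>a b. \<forall>t. (\<Prod>j\<in>J. (\<chi> j. if j = i then t else x $ j) $ e j) = a + b * t"
  proof (cases "i \<in> e ` J")
    case True
    then obtain k where k: "k \<in> J" "i = e k" by auto
    have "(\<Prod>j\<in>J. (\<chi> j. if j = i then t else x $ j) $ e j) = 0 + (\<Prod>j\<in>J - {k}. x $ e j) * t" for t
    proof -
      have "(\<Prod>j\<in>J. (\<chi> j. if j = i then t else x $ j) $ e j)
          = t * (\<Prod>j\<in>J - {k}. (\<chi> j. if j = i then t else x $ j) $ e j)"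
        using k assms(2) by (subst prod.remove[of J k]) auto
      also have "(\<Prod>j\<in>J - {k}. (\<chi> j. if j = i then t else x $ j) $ e j) = (\<Prod>j\<in>J - {k}. x $ e j)"
        using k assms(1) by (intro prod.cong) (auto dest: inj_onD)
      finally show ?thesis by simp
    qed
    then show ?thesis by blast
  next
    case False
    then have "(\<Prod>j\<in>J. (\<chi> j. if j = i then t else x $ j) $ e j) = (\<Prod>j\<in>J. x $ e j) + 0 * t" for t
      by (auto intro!: prod.cong)
    then show ?thesis by blast
  qed
qed

lemma coordinatewise_affine_coordinate: "coordinatewise_affine (\<lambda>x. x $ i)"
  using coordinatewise_affine_monomial[of "\<lambda>_. i" "{()}"] by simp

lemma coordinatewise_affine_ineq_lhs:
  fixes e :: "nat \<Rightarrow> 'n::finite"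
  assumes "bij_betw e {1..CARD('n)} UNIV"
  shows "coordinatewise_affine (\<lambda>x. ineq_lhs e \<beta>0 \<beta> \<beta>' x (multilin e c x))"
proof -
  have inj: "inj_on e J" if "J \<subseteq> {1..CARD('n)}" for J
    using assms that by (metis bij_betw_imp_inj_on inj_on_subset)
  show ?thesis
    unfolding ineq_lhs_def multilin_def
    by (intro coordinatewise_affine_add coordinatewise_affine_const coordinatewise_affine_sum
        coordinatewise_affine_scale coordinatewise_affine_coordinate
        coordinatewise_affine_monomial)
      (auto simp del: One_nat_def intro: inj finite_subset)
qed

text \<open>
  Along a single coordinate the function is affine and nonnegative on \<open>[l, u]\<close>; if it vanishes at
  an interior point it vanishes throughout, so this coordinate may be moved to either end.
\<close>

lemma round_zero_to_vertex:
  fixes g :: "real ^ 'n \<Rightarrow> real"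
  assumes aff: "coordinatewise_affine g"
    and nonneg: "\<And>x. (\<And>i. l \<le> x $ i \<and> x $ i \<le> u) \<Longrightarrow> g x \<ge> 0"
    and "l \<le> u"
    and x: "\<And>i. l \<le> x $ i \<and> x $ i \<le> u" and zero: "g x = 0"
    and v: "\<And>i. v $ i \<in> {l, u}" and agree: "\<And>i. x $ i \<in> {l, u} \<Longrightarrow> v $ i = x $ i"
  shows "g v = 0"
proof -
  have "g (\<chi> i. if i \<in> A then v $ i else x $ i) = 0" if "finite A" for A
    using that
  proof (induction A rule: finite_induct)
    case empty
    then show ?case using zero by simp
  next
    case (insert k A)
    define w where "w = (\<chi> i. if i \<in> A then v $ i else x $ i)"
    have w: "l \<le> w $ i \<and> w $ i \<le> u" for i
      using x v[of i] \<open>l \<le> u\<close> by (auto simp: w_def)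
    obtain a b where ab: "g (\<chi> j. if j = k then t else w $ j) = a + b * t" for t
      using aff unfolding coordinatewise_affine_def by meson
    have pos: "a + b * t \<ge> 0" if "l \<le> t" "t \<le> u" for t
      using nonneg[of "\<chi> j. if j = k then t else w $ j"] w that ab[of t] by auto
    have "(\<chi> j. if j = k then x $ k else w $ j) = w"
      using insert.hyps by (auto simp: vec_eq_iff w_def)
    then have z: "a + b * x $ k = 0"
      using ab[of "x $ k"] insert.IH by (simp add: w_def)
    have "a + b * v $ k = 0"
    proof (cases "x $ k \<in> {l, u}")
      case True
      then show ?thesis using agree z by simp
    next
      case False
      then have lt: "l < x $ k" "x $ k < u" using x[of k] by (auto simp: less_le)
      have "b * (l - x $ k) \<ge> 0" "b * (u - x $ k) \<ge> 0"
        using pos[of l] pos[of u] z \<open>l \<le> u\<close> by (auto simp: algebra_simps)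
      with lt have "b = 0" by (auto simp: zero_le_mult_iff)
      then show ?thesis using z by simp
    qed
    moreover have "(\<chi> i. if i \<in> insert k A then v $ i else x $ i)
        = (\<chi> j. if j = k then v $ k else w $ j)"
      by (auto simp: vec_eq_iff w_def)
    ultimately show ?case using ab[of "v $ k"] by simp
  qed
  from this[of UNIV] show ?thesis by (simp add: vec_lambda_eta)
qed

section \<open>Vertices of the box\<close>

definition vertex :: "(nat \<Rightarrow> 'n::finite) \<Rightarrow> real \<Rightarrow> real \<Rightarrow> nat set \<Rightarrow> real ^ 'n" where
  "vertex e l u S = (\<chi> i. if i \<in> e ` S then u else l)"

lemma point_x_eq_vertex: "point_x e l u k = vertex e l u {1..k}"
  by (simp add: point_x_def vertex_def)

lemma vertex_nth:
  assumes "inj_on e N" "S \<subseteq> N" "j \<in> N"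
  shows "vertex e l u S $ e j = (if j \<in> S then u else l)"
  using inj_on_image_mem_iff[OF assms(1,3,2)] by (simp add: vertex_def)

lemma vertex_in_box: "l \<le> u \<Longrightarrow> vertex e l u S \<in> box_X e l u"
  by (auto simp: box_X_def vertex_def)

lemma ex_permutation_between_equicard_subsets:
  assumes "finite N" "S \<subseteq> N" "T \<subseteq> N" "card S = card T"
  obtains p where "bij_betw p N N" "\<And>j. j \<in> N \<Longrightarrow> p j \<in> T \<longleftrightarrow> j \<in> S"
proof -
  have fin: "finite S" "finite T" using assms finite_subset by auto
  obtain f where f: "bij_betw f S T"
    using finite_same_card_bij[OF fin assms(4)] by blast
  have "card (N - S) = card (N - T)"
    using assms fin by (simp add: card_Diff_subset)
  then obtain g where g: "bij_betw g (N - S) (N - T)"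
    using finite_same_card_bij[of "N - S" "N - T"] assms(1) by blast
  let ?p = "\<lambda>j. if j \<in> S then f j else g j"
  have "bij_betw ?p (S \<union> (N - S)) (T \<union> (N - T))"
    using f g by (intro bij_betw_disjoint_Un) auto
  then have "bij_betw ?p N N"
    using assms(2,3) by (simp add: Un_absorb1)
  moreover have "?p j \<in> T \<longleftrightarrow> j \<in> S" if "j \<in> N" for j
    using that bij_betwE[OF f] bij_betwE[OF g] by auto
  ultimately show thesis using that by blast
qed

text \<open>
  By symmetry of \<open>m\<close>: a permutation of the coordinates carrying \<open>S\<close> to \<open>T\<close> permutes the
  monomials of each degree.
\<close>

lemma multilin_vertex_cong_card:
  fixes e :: "nat \<Rightarrow> 'n::finite"
  assumes inj: "inj_on e {1..CARD('n)}"
    and S: "S \<subseteq> {1..CARD('n)}" and T: "T \<subseteq> {1..CARD('n)}" and card: "card S = card T"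
  shows "multilin e c (vertex e l u S) = multilin e c (vertex e l u T)"
proof -
  let ?N = "{1..CARD('n)}"
  obtain p where p: "bij_betw p ?N ?N" and pT: "\<And>j. j \<in> ?N \<Longrightarrow> p j \<in> T \<longleftrightarrow> j \<in> S"
    using ex_permutation_between_equicard_subsets[OF _ S T card] by (metis finite_atLeastAtMost)
  have injp: "inj_on p ?N" and imp: "p ` ?N = ?N"
    using p by (auto simp: bij_betw_def)
  have sub: "bij_betw (image p) {J. J \<subseteq> ?N \<and> card J = i} {J. J \<subseteq> ?N \<and> card J = i}" for i
  proof (rule bij_betw_byWitness[where f' = "image (inv_into ?N p)"])
    have inv: "inv_into ?N p (p a) = a" if "a \<in> ?N" for a
      using injp that by simp
    have inv': "p (inv_into ?N p a) = a" "inv_into ?N p a \<in> ?N" if "a \<in> ?N" for a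
      using imp that by (metis f_inv_into_f, metis inv_into_into)
    have injq: "inj_on (inv_into ?N p) ?N"
      using inv' by (metis inj_on_inverseI)
    show "\<forall>J\<in>{J. J \<subseteq> ?N \<and> card J = i}. inv_into ?N p ` (p ` J) = J"
      using injp by (auto simp: inv_into_image_cancel)
    show "\<forall>J\<in>{J. J \<subseteq> ?N \<and> card J = i}. p ` (inv_into ?N p ` J) = J"
      using imp by (auto simp: image_inv_into_cancel)
    show "image p ` {J. J \<subseteq> ?N \<and> card J = i} \<subseteq> {J. J \<subseteq> ?N \<and> card J = i}"
      using injp imp by (auto simp: card_image inj_on_subset)
    show "image (inv_into ?N p) ` {J. J \<subseteq> ?N \<and> card J = i} \<subseteq> {J. J \<subseteq> ?N \<and> card J = i}"
    proof clarify
      fix J assume J: "J \<subseteq> ?N" "i = card J"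
      then have "card (inv_into ?N p ` J) = card J"
        using injq by (metis card_image inj_on_subset)
      then show "inv_into ?N p ` J \<subseteq> ?N \<and> card (inv_into ?N p ` J) = card J"
        using inv'(2) J(1) by blast
    qed
  qed
  have "(\<Sum>J | J \<subseteq> ?N \<and> card J = i. \<Prod>j\<in>J. vertex e l u T $ e j)
      = (\<Sum>J | J \<subseteq> ?N \<and> card J = i. \<Prod>j\<in>J. vertex e l u S $ e j)" for i
  proof -
    have "(\<Sum>J | J \<subseteq> ?N \<and> card J = i. \<Prod>j\<in>J. vertex e l u T $ e j)
        = (\<Sum>J | J \<subseteq> ?N \<and> card J = i. \<Prod>j\<in>p ` J. vertex e l u T $ e j)"
      by (rule sum.reindex_bij_betw[OF sub, symmetric])
    also have "\<dots> = (\<Sum>J | J \<subseteq> ?N \<and> card J = i. \<Prod>j\<in>J. vertex e l u S $ e j)"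
    proof (rule sum.cong[OF refl])
      fix J assume "J \<in> {J. J \<subseteq> ?N \<and> card J = i}"
      then have J: "J \<subseteq> ?N" by simp
      have "(\<Prod>j\<in>p ` J. vertex e l u T $ e j) = (\<Prod>j\<in>J. vertex e l u T $ e (p j))"
        using inj_on_subset[OF injp J] by (simp add: prod.reindex)
      also have "\<dots> = (\<Prod>j\<in>J. vertex e l u S $ e j)"
      proof (rule prod.cong[OF refl])
        fix j assume "j \<in> J"
        then have j: "j \<in> ?N" using J by blast
        then have "p j \<in> ?N" using imp by blast
        then show "vertex e l u T $ e (p j) = vertex e l u S $ e j"
          using vertex_nth[OF inj S j] vertex_nth[OF inj T] pT[OF j] by simp
      qed
      finally show "(\<Prod>j\<in>p ` J. vertex e l u T $ e j) = (\<Prod>j\<in>J. vertex e l u S $ e j)" .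
    qed
    finally show ?thesis .
  qed
  then show ?thesis by (simp add: multilin_def)
qed

lemma linear_part_vertex:
  fixes \<beta> :: "nat \<Rightarrow> real"
  assumes "inj_on e N" "finite N" "S \<subseteq> N"
  shows "(\<Sum>j\<in>N. \<beta> j * vertex e l u S $ e j) = l * (\<Sum>j\<in>N. \<beta> j) + (u - l) * (\<Sum>j\<in>S. \<beta> j)"
proof -
  have "(\<Sum>j\<in>N. \<beta> j * vertex e l u S $ e j)
      = (\<Sum>j\<in>N. l * \<beta> j + (u - l) * (if j \<in> S then \<beta> j else 0))"
    using vertex_nth[OF assms(1,3)] by (intro sum.cong) (auto simp: algebra_simps)
  also have "\<dots> = l * (\<Sum>j\<in>N. \<beta> j) + (u - l) * (\<Sum>j\<in>N. if j \<in> S then \<beta> j else 0)"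
    by (simp add: sum.distrib sum_distrib_left)
  also have "(\<Sum>j\<in>N. if j \<in> S then \<beta> j else 0) = (\<Sum>j\<in>S. \<beta> j)"
    using assms(2,3) by (simp add: sum.If_cases Int_absorb1)
  finally show ?thesis .
qed

lemma Lk_eq_ineq_lhs:
  fixes e :: "nat \<Rightarrow> 'n::finite"
  assumes "inj_on e {1..CARD('n)}" "k \<le> CARD('n)"
  shows "Lk CARD('n) l u k \<beta>0 \<beta> + \<beta>' * y = ineq_lhs e \<beta>0 \<beta> \<beta>' (vertex e l u {1..k}) y"
proof -
  have "{1..CARD('n)} = {1..k} \<union> {k + 1..CARD('n)}" using assms(2) by auto
  then have "(\<Sum>j=1..CARD('n). \<beta> j) = (\<Sum>j=1..k. \<beta> j) + (\<Sum>j=k+1..CARD('n). \<beta> j)"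
    by (simp only:) (rule sum.union_disjoint, auto)
  moreover have "{1..k} \<subseteq> {1..CARD('n)}" using assms(2) by auto
  ultimately show ?thesis
    using linear_part_vertex[OF assms(1) finite_atLeastAtMost, of "{1..k}" \<beta> l u]
    by (simp add: Lk_def ineq_lhs_def algebra_simps)
qed

text \<open>
  With \<open>k = card S\<close>, the indices of \<open>{1..k}\<close> outside \<open>S\<close> are as many as those of \<open>S\<close>
  outside \<open>{1..k}\<close>, and \<open>\<beta> k\<close> separates the values of \<open>\<beta>\<close> at the former from those at the latter.
\<close>

lemma sum_initial_segment_le:
  fixes \<beta> :: "nat \<Rightarrow> real"
  assumes mono: "\<And>i j. 1 \<le> i \<Longrightarrow> i \<le> j \<Longrightarrow> j \<le> n \<Longrightarrow> \<beta> i \<le> \<beta> j" and S: "S \<subseteq> {1..n}"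
  shows "(\<Sum>j=1..card S. \<beta> j) \<le> (\<Sum>j\<in>S. \<beta> j)"
proof -
  define k where "k = card S"
  have fin: "finite S" using S finite_subset by blast
  have k: "k \<le> n" using card_mono[OF _ S] by (simp add: k_def)
  have card: "card ({1..k} - S) = card (S - {1..k})"
    using card_Diff_subset_Int[of "{1..k}" S] card_Diff_subset_Int[of S "{1..k}"] fin
    by (simp add: k_def Int_commute)
  have "(\<Sum>j\<in>{1..k} - S. \<beta> j) \<le> of_nat (card ({1..k} - S)) * \<beta> k"
    using k by (intro sum_bounded_above) (auto intro!: mono)
  also have "\<dots> \<le> (\<Sum>j\<in>S - {1..k}. \<beta> j)"
  proof (cases "k = 0")
    case True
    then have "S = {}" using fin by (simp add: k_def)
    then show ?thesis using True by simp
  next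
    case False
    then show ?thesis
      unfolding card using S by (intro sum_bounded_below) (auto intro!: mono)
  qed
  finally have "(\<Sum>j\<in>{1..k} - S. \<beta> j) \<le> (\<Sum>j\<in>S - {1..k}. \<beta> j)" .
  moreover have "(\<Sum>j=1..k. \<beta> j) = (\<Sum>j\<in>{1..k} \<inter> S. \<beta> j) + (\<Sum>j\<in>{1..k} - S. \<beta> j)"
    by (rule sum.Int_Diff) simp
  moreover have "(\<Sum>j\<in>S. \<beta> j) = (\<Sum>j\<in>S \<inter> {1..k}. \<beta> j) + (\<Sum>j\<in>S - {1..k}. \<beta> j)"
    using fin by (rule sum.Int_Diff)
  ultimately show ?thesis by (simp add: k_def Int_commute)
qed

section \<open>Dimension of the convex hull of the graph\<close>

lemma multilin_diagonal:
  fixes e :: "nat \<Rightarrow> 'n::finite"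
  shows "multilin e c (\<chi> i. t) = (\<Sum>i=2..CARD('n). c i * of_nat (CARD('n) choose i) * t ^ i)"
  unfolding multilin_def
  by (rule sum.cong) (auto simp: n_subsets)

text \<open>
  If a hyperplane contained the graph, then its equation on the diagonal of the box would be a
  polynomial identity in one variable.  Some \<open>c i\<close> with \<open>i \<ge> 2\<close> is nonzero, so comparing the
  coefficients of degree \<open>i\<close> shows that the hyperplane is vertical; but the box itself lies in no
  hyperplane.
\<close>

lemma aff_dim_graph_hull:
  fixes e :: "nat \<Rightarrow> 'n::finite"
  assumes bij: "bij_betw e {1..CARD('n)} UNIV" and lu: "l < u"
    and c: "\<exists>i\<in>{2..CARD('n)}. c i \<noteq> 0"
  shows "aff_dim (convex hull (graph_G e l u c)) = DIM((real ^ 'n) \<times> real)"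
proof (rule ccontr)
  assume "aff_dim (convex hull (graph_G e l u c)) \<noteq> DIM((real ^ 'n) \<times> real)"
  then have "aff_dim (graph_G e l u c) < DIM((real ^ 'n) \<times> real)"
    using aff_dim_le_DIM[of "graph_G e l u c"] by (simp add: aff_dim_convex_hull)
  then obtain ab d where ab0: "ab \<noteq> 0" and ab: "graph_G e l u c \<subseteq> {z. ab \<bullet> z = d}"
    using aff_lowdim_subset_hyperplane by metis
  obtain a b where [simp]: "ab = (a, b)" by (cases ab)
  have eq: "a \<bullet> x + b * multilin e c x = d" if "x \<in> box_X e l u" for x
    using ab that by (auto simp: graph_G_def)
  define q where "q i = (if i = 0 then - d else if i = 1 then \<Sum>i\<in>UNIV. a $ i
      else b * c i * of_nat (CARD('n) choose i))" for i
  have q: "(\<Sum>i\<le>CARD('n). q i * t ^ i) = 0" if "t \<in> {l..u}" for t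
  proof -
    have n: "CARD('n) \<ge> 2" using c by auto
    have "{..CARD('n)} = {0, 1} \<union> {2..CARD('n)}" using n by auto
    then have "(\<Sum>i\<le>CARD('n). q i * t ^ i)
        = (\<Sum>i\<in>{0, 1}. q i * t ^ i) + (\<Sum>i=2..CARD('n). q i * t ^ i)"
      by (simp only:) (rule sum.union_disjoint, auto)
    also have "(\<Sum>i=2..CARD('n). q i * t ^ i)
        = (\<Sum>i=2..CARD('n). b * (c i * of_nat (CARD('n) choose i) * t ^ i))"
      by (rule sum.cong) (auto simp: q_def)
    also have "\<dots> = b * multilin e c (\<chi> i. t)"
      by (simp add: multilin_diagonal sum_distrib_left)
    also have "(\<Sum>i\<in>{0, 1}. q i * t ^ i) = a \<bullet> (\<chi> i. t) - d"
      by (simp add: q_def inner_vec_def sum_distrib_right)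
    finally show ?thesis
      using eq[of "\<chi> i. t"] that by (auto simp: box_X_def)
  qed
  have "infinite {t. (\<Sum>i\<le>CARD('n). q i * t ^ i) = 0}"
    using q infinite_Icc[OF lu] by (metis (mono_tags, lifting) infinite_super mem_Collect_eq subsetI)
  then have q0: "q i = 0" if "i \<le> CARD('n)" for i
    using polyfun_finite_roots[of q "CARD('n)"] that by blast
  obtain i where "i \<in> {2..CARD('n)}" "c i \<noteq> 0" using c by blast
  with q0[of i] have b: "b = 0" by (auto simp: q_def)
  have "a $ k = 0" for k
  proof -
    have "l \<le> u" using lu by simp
    have "a \<bullet> (\<chi> i. if i = k then u else l) = d" "a \<bullet> (\<chi> i. l) = d"
      using eq b \<open>l \<le> u\<close> by (auto simp: box_X_def)
    then have "a \<bullet> ((\<chi> i. if i = k then u else l) - (\<chi> i. l)) = 0"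
      by (simp add: inner_diff_right)
    also have "(\<chi> i. if i = k then u else l) - (\<chi> i. l) = (u - l) *\<^sub>R axis k 1"
      by (auto simp: vec_eq_iff axis_def)
    finally show ?thesis using lu by (simp add: inner_axis)
  qed
  then have "a = 0" by (simp add: vec_eq_iff)
  then show False using ab0 b by (simp add: zero_prod_def)
qed

section \<open>Tight vertices of a core facet\<close>

text \<open>
  If the points of a set that lie on a supporting hyperplane \<open>a \<bullet> z = b\<close> all satisfy the equation
  \<open>p \<bullet> z = d\<close>, then so does the face of its convex hull cut out by this hyperplane: the set below
  is convex, so it contains the hull.
\<close>

lemma convex_lexicographic_halfspace:
  "convex {z. a \<bullet> z > b \<or> a \<bullet> z = b \<and> p \<bullet> z = (d::real)}"
proof (rule convexI)
  fix y z :: 'a and s t :: real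
  assume y: "y \<in> {z. a \<bullet> z > b \<or> a \<bullet> z = b \<and> p \<bullet> z = d}"
    and z: "z \<in> {z. a \<bullet> z > b \<or> a \<bullet> z = b \<and> p \<bullet> z = d}"
    and st: "0 \<le> s" "0 \<le> t" "s + t = 1"
  have comb: "s * d' + t * d' = d'" for d' using st(3) by (metis distrib_right mult_1)
  show "s *\<^sub>R y + t *\<^sub>R z \<in> {z. a \<bullet> z > b \<or> a \<bullet> z = b \<and> p \<bullet> z = d}"
  proof (cases "s = 0 \<or> t = 0")
    case True
    then show ?thesis using y z st by auto
  next
    case False
    then have pos: "s > 0" "t > 0" using st by auto
    show ?thesis
    proof (cases "a \<bullet> y = b \<and> a \<bullet> z = b")
      case True
      then show ?thesis using y z comb by (auto simp: inner_add_right)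
    next
      case False
      then have "s * (a \<bullet> y - b) + t * (a \<bullet> z - b) > 0"
        using y z pos by (smt (verit) mem_Collect_eq mult_pos_pos mult_eq_0_iff)
      then have "s * (a \<bullet> y) + t * (a \<bullet> z) > b"
        using comb[of b] by (simp add: algebra_simps)
      then show ?thesis by (simp add: inner_add_right)
    qed
  qed
qed

text \<open>
  A facet of a full-dimensional set has the dimension of a hyperplane, so its affine hull is equal
  to every hyperplane containing it.
\<close>

lemma facet_hyperplane_unique:
  fixes S :: "'a::euclidean_space set"
  assumes F: "F facet_of S" and dim: "aff_dim S = DIM('a)"
    and sub: "F \<subseteq> {z. a \<bullet> z = b}" "F \<subseteq> {z. p \<bullet> z = d}" and "a \<noteq> 0" "p \<noteq> 0"
  shows "{z. a \<bullet> z = b} = {z. p \<bullet> z = d}"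
proof -
  have "affine hull F = {z. q \<bullet> z = f}" if "F \<subseteq> {z. q \<bullet> z = f}" "q \<noteq> 0" for q f
  proof (rule affine_dim_equal)
    show "affine hull F \<noteq> {}" using F by (auto simp: facet_of_def)
    show "affine hull F \<subseteq> {z. q \<bullet> z = f}"
      using that by (simp add: hull_minimal affine_hyperplane)
    show "aff_dim (affine hull F) = aff_dim {z. q \<bullet> z = f}"
      using F dim that by (simp add: facet_of_def aff_dim_hyperplane)
  qed (auto simp: affine_hyperplane)
  then show ?thesis using assms by metis
qed

text \<open>
  The hyperplane spanned by the facet is not vertical, so the facet leaves \<open>x\<^sub>k = d\<close>.  It is the
  hull of its points of the graph, and one of these points off \<open>x\<^sub>k = d\<close> can be rounded to a vertex.
\<close>

lemma core_facet_tight_vertex: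
  fixes e :: "nat \<Rightarrow> 'n::finite"
  assumes bij: "bij_betw e {1..CARD('n)} UNIV" and lu: "l < u"
    and c: "\<exists>i\<in>{2..CARD('n)}. c i \<noteq> 0"
    and facet: "core_facet e l u c \<beta>0 \<beta> \<beta>'"
    and k: "k \<in> {1..CARD('n)}" and d: "d \<in> {l, u}"
  obtains S where "S \<subseteq> {1..CARD('n)}"
    "ineq_lhs e \<beta>0 \<beta> \<beta>' (vertex e l u S) (multilin e c (vertex e l u S)) = 0"
    "vertex e l u S $ e k \<noteq> d"
proof -
  let ?N = "{1..CARD('n)}" and ?P = "convex hull (graph_G e l u c)"
  let ?h = "\<lambda>x. ineq_lhs e \<beta>0 \<beta> \<beta>' x (multilin e c x)"
  let ?F = "{(x, y) \<in> ?P. ineq_lhs e \<beta>0 \<beta> \<beta>' x y = 0}"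
  have inj: "inj_on e ?N" and surj: "e ` ?N = UNIV"
    using bij by (auto simp: bij_betw_def)
  have box: "x \<in> box_X e l u \<longleftrightarrow> (\<forall>i. l \<le> x $ i \<and> x $ i \<le> u)" for x
    unfolding box_X_def using surj by (auto, (metis imageE UNIV_I)+)
  have \<beta>': "\<beta>' \<noteq> 0" and valid: "\<forall>(x, y) \<in> ?P. ineq_lhs e \<beta>0 \<beta> \<beta>' x y \<ge> 0"
    and F: "?F facet_of ?P"
    using facet by (auto simp: core_facet_def core_inequality_def)
  have h_nonneg: "?h x \<ge> 0" if "x \<in> box_X e l u" for x
  proof -
    have "(x, multilin e c x) \<in> ?P"
      using that by (intro hull_inc) (simp add: graph_G_def)
    then show ?thesis using valid by auto
  qed
  define a where "a = ((\<chi> i. \<beta> (inv_into ?N e i)) :: real ^ 'n, \<beta>')"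
  define p where "p = (axis (e k) 1 :: real ^ 'n, 0 :: real)"
  have h: "ineq_lhs e \<beta>0 \<beta> \<beta>' x y = a \<bullet> (x, y) + \<beta>0" for x y
  proof -
    have "(\<chi> i. \<beta> (inv_into ?N e i)) \<bullet> x = (\<Sum>i\<in>UNIV. \<beta> (inv_into ?N e i) * x $ i)"
      by (simp add: inner_vec_def)
    also have "\<dots> = (\<Sum>j\<in>?N. \<beta> (inv_into ?N e (e j)) * x $ e j)"
      by (rule sum.reindex_bij_betw[OF bij, symmetric])
    also have "\<dots> = (\<Sum>j\<in>?N. \<beta> j * x $ e j)"
      using inj by (intro sum.cong) auto
    finally show ?thesis by (simp add: ineq_lhs_def a_def)
  qed
  have p: "p \<bullet> (x, y) = x $ e k" for x y
    by (simp add: p_def inner_axis inner_commute)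
  have "\<exists>x \<in> box_X e l u. ?h x = 0 \<and> x $ e k \<noteq> d"
  proof (rule ccontr)
    assume contra: "\<not> ?thesis"
    \<comment> \<open>Validity and the assumption put the graph, and hence its hull, into this convex set.\<close>
    have "graph_G e l u c \<subseteq> {z. a \<bullet> z > - \<beta>0 \<or> a \<bullet> z = - \<beta>0 \<and> p \<bullet> z = d}"
      using contra h_nonneg by (fastforce simp: graph_G_def h p)
    then have "?P \<subseteq> {z. a \<bullet> z > - \<beta>0 \<or> a \<bullet> z = - \<beta>0 \<and> p \<bullet> z = d}"
      using convex_lexicographic_halfspace by (rule hull_minimal)
    then have sub: "?F \<subseteq> {z. a \<bullet> z = - \<beta>0}" "?F \<subseteq> {z. p \<bullet> z = d}"
      by (auto simp: h)
    have "a \<noteq> 0" "p \<noteq> 0" using \<beta>' by (auto simp: a_def p_def zero_prod_def axis_eq_0_iff)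
    then have eq: "{z. a \<bullet> z = - \<beta>0} = {z. p \<bullet> z = d}"
      by (intro facet_hyperplane_unique[OF F aff_dim_graph_hull[OF bij lu c] sub])
    \<comment> \<open>The second hyperplane is vertical, the first is not.\<close>
    have "(axis (e k) d, y) \<in> {z. p \<bullet> z = d}" for y by (simp add: p)
    then have "a \<bullet> (axis (e k) d, y) = - \<beta>0" for y using eq by blast
    from this[of 0] this[of 1] have "a \<bullet> (axis (e k) d, 0) = a \<bullet> (axis (e k) d, 1)" by simp
    then show False using \<beta>' by (simp add: a_def)
  qed
  then obtain x where x: "x \<in> box_X e l u" "?h x = 0" "x $ e k \<noteq> d" by blast
  \<comment> \<open>Interior coordinates are rounded to the end of the interval opposite to \<open>d\<close>.\<close>
  define v where "v = (\<chi> i. if x $ i \<in> {l, u} then x $ i else l + u - d)"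
  have v: "v $ i \<in> {l, u}" for i using d by (auto simp: v_def)
  have "?h v = 0"
  proof (rule round_zero_to_vertex[where g = ?h])
    show "coordinatewise_affine ?h" using bij by (rule coordinatewise_affine_ineq_lhs)
    show "?h x \<ge> 0" if "\<And>i. l \<le> x $ i \<and> x $ i \<le> u" for x
      using that by (intro h_nonneg) (simp add: box)
    show "l \<le> x $ i \<and> x $ i \<le> u" for i using x(1) box by blast
  qed (use x(2) v lu in \<open>auto simp: v_def\<close>)
  moreover have "v $ e k \<noteq> d" using x(3) d lu by (auto simp: v_def)
  moreover have "v = vertex e l u {j \<in> ?N. v $ e j = u}"
  proof -
    have "i \<in> e ` {j \<in> ?N. v $ e j = u} \<longleftrightarrow> v $ i = u" for i
    proof -
      obtain j where "j \<in> ?N" "i = e j" using surj by blast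
      then show ?thesis using inj by (auto dest: inj_onD)
    qed
    then show ?thesis using v by (auto simp: vertex_def vec_eq_iff)
  qed
  ultimately show thesis using that[of "{j \<in> ?N. v $ e j = u}"]
    by (metis (lifting) mem_Collect_eq subsetI)
qed

theorem proposition3p5:
  fixes e :: "nat \<Rightarrow> 'n::finite" and n r s :: nat
    and l u \<beta>0 \<beta>' :: real and c \<beta> :: "nat \<Rightarrow> real"
  assumes "n = CARD('n)" and "n \<ge> 2"
    and "bij_betw e {1..n} UNIV"
    and "l < u"
    and "\<exists>i\<in>{2..n}. c i \<noteq> 0"
    and "core_facet e l u c \<beta>0 \<beta> \<beta>'"
    and "r = Min {k \<in> {0..n - 1}. Lk n l u k \<beta>0 \<beta> + \<beta>' * multilin e c (point_x e l u k) = 0}"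
    and "s = Max {k \<in> {1..n}. Lk n l u k \<beta>0 \<beta> + \<beta>' * multilin e c (point_x e l u k) = 0}"
  shows "(\<forall>j\<in>{1..r + 1}. \<beta> j = \<beta> 1) \<and> (\<forall>j\<in>{s..n}. \<beta> j = \<beta> n)"
proof -
  note n = assms(1)
  have inj: "inj_on e {1..CARD('n)}" using assms(1,3) by (simp add: bij_betw_def)
  note tight_vertex = core_facet_tight_vertex[OF assms(3)[unfolded n] assms(4)
      assms(5)[unfolded n] assms(6)]
  let ?f = "\<lambda>S. ineq_lhs e \<beta>0 \<beta> \<beta>' (vertex e l u S) (multilin e c (vertex e l u S))"
  let ?tight = "\<lambda>k. Lk n l u k \<beta>0 \<beta> + \<beta>' * multilin e c (point_x e l u k) = 0"
  have f_nonneg: "?f S \<ge> 0" for S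
  proof -
    have "(vertex e l u S, multilin e c (vertex e l u S)) \<in> convex hull (graph_G e l u c)"
      using assms(4) by (intro hull_inc) (simp add: graph_G_def vertex_in_box)
    then show ?thesis using assms(6) by (auto simp: core_facet_def)
  qed
  \<comment> \<open>Between vertices of the same level only the linear part of the inequality changes.\<close>
  have f_diff: "?f S - ?f T = (u - l) * ((\<Sum>j\<in>S. \<beta> j) - (\<Sum>j\<in>T. \<beta> j))"
    if "S \<subseteq> {1..n}" "T \<subseteq> {1..n}" "card S = card T" for S T
    using that linear_part_vertex[OF inj finite_atLeastAtMost, of S \<beta> l u]
      linear_part_vertex[OF inj finite_atLeastAtMost, of T \<beta> l u]
      multilin_vertex_cong_card[OF inj, of S T c l u] n
    by (simp add: ineq_lhs_def algebra_simps)
  have mono: "\<beta> i \<le> \<beta> j" if "1 \<le> i" "i \<le> j" "j \<le> n" for i j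
    using that(2,1,3)
  proof (induction j rule: dec_induct)
    case (step m)
    then have "\<beta> m \<le> \<beta> (m + 1)"
      using assms(6) n by (auto simp: core_facet_def core_inequality_def)
    then show ?case using step by simp
  qed simp
  \<comment> \<open>On each level the vertex \<open>x\<^sup>k\<close> minimizes the left-hand side.\<close>
  have tight_card: "?tight (card S)" if S: "S \<subseteq> {1..n}" and zero: "?f S = 0" for S
  proof -
    have k: "card S \<le> n" using card_mono[OF _ S] by simp
    have "0 \<le> ?f S - ?f {1..card S}"
      using f_diff[OF S, of "{1..card S}"] k sum_initial_segment_le[OF mono S] assms(4) by simp
    then have "?f {1..card S} = 0" using zero f_nonneg[of "{1..card S}"] by linarith
    then show ?thesis
      using Lk_eq_ineq_lhs[OF inj] k n by (simp add: point_x_eq_vertex)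
  qed
  have exchange: "\<beta> a = \<beta> b"
    if S: "S \<subseteq> {1..n}" "?f S = 0" and ab: "a \<in> {1..n}" "a \<notin> S" "b \<in> S" "a \<le> b" for S a b
  proof -
    let ?T = "insert a (S - {b})"
    have fin: "finite S" using S finite_subset by blast
    have "card ?T = card S" using ab fin card.remove[of S b] by simp
    moreover have "(\<Sum>j\<in>?T. \<beta> j) = (\<Sum>j\<in>S. \<beta> j) - \<beta> b + \<beta> a"
      using ab fin sum.remove[of S b \<beta>] by simp
    moreover have "?T \<subseteq> {1..n}" using S ab by auto
    ultimately have "?f S - ?f ?T = (u - l) * (\<beta> b - \<beta> a)"
      using f_diff[of S ?T] S by simp
    then have "(u - l) * (\<beta> b - \<beta> a) \<le> 0" using S(2) f_nonneg[of ?T] by linarith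
    then have "\<beta> b \<le> \<beta> a" using assms(4) by (simp add: mult_le_0_iff)
    moreover have "\<beta> a \<le> \<beta> b" using ab S by (intro mono) auto
    ultimately show ?thesis by simp
  qed
  have "\<beta> j = \<beta> 1" if j: "j \<in> {1..r + 1}" for j
  proof -
    obtain S where S: "S \<subseteq> {1..n}" "?f S = 0" "vertex e l u S $ e 1 \<noteq> u"
      using tight_vertex[of 1 u] assms(2) n by auto
    then have 1: "1 \<notin> S" using vertex_nth[OF inj] assms(1,2) by auto
    have "S \<subseteq> {2..n}"
    proof
      fix x assume "x \<in> S"
      then have "x \<noteq> 1" "1 \<le> x" "x \<le> n" using S(1) 1 by auto
      then show "x \<in> {2..n}" by simp
    qed
    then have "card S \<le> n - 1" using card_mono[of "{2..n}" S] by simp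
    then have r: "r \<le> card S" unfolding assms(7) using tight_card[OF S(1,2)] by (intro Min_le) auto
    show ?thesis
    proof (cases "r = 0")
      case True
      then show ?thesis using j by simp
    next
      case False
      have "\<not> S \<subseteq> {2..r}"
      proof
        assume "S \<subseteq> {2..r}"
        then have "card S \<le> r - 1" using card_mono[of "{2..r}" S] by simp
        then show False using r False by simp
      qed
      then obtain b where b: "b \<in> S" "r < b" using \<open>S \<subseteq> {2..n}\<close> by force
      then have bn: "b \<le> n" using S(1) by auto
      have "\<beta> 1 = \<beta> b" using exchange[OF S(1,2), of 1 b] 1 b bn by auto
      moreover have "\<beta> 1 \<le> \<beta> j" "\<beta> j \<le> \<beta> b" using j b bn by (auto intro!: mono)
      ultimately show ?thesis by simp
    qed
  qed
  moreover have "\<beta> j = \<beta> n" if j: "j \<in> {s..n}" for j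
  proof -
    obtain S where S: "S \<subseteq> {1..n}" "?f S = 0" "vertex e l u S $ e n \<noteq> l"
      using tight_vertex[of n l] assms(2) n by auto
    then have nS: "n \<in> S" using vertex_nth[OF inj] assms(1,2) by (auto split: if_splits)
    have fin: "finite S" using S finite_subset by blast
    have "card S \<ge> 1" using nS fin by (metis card_0_eq empty_iff less_one not_le)
    moreover have "card S \<le> n" using card_mono[OF _ S(1)] by simp
    ultimately have s: "card S \<le> s"
      unfolding assms(8) using tight_card[OF S(1,2)] by (intro Max_ge) auto
    show ?thesis
    proof (cases "s < n")
      case False
      then have "j = n" using j by simp
      then show ?thesis by simp
    next
      case True
      have "\<not> {1..s} \<subseteq> S"
      proof
        assume "{1..s} \<subseteq> S"
        then have "insert n {1..s} \<subseteq> S" using nS by simp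
        from card_mono[OF fin this] show False using True s by simp
      qed
      then obtain a where a: "a \<in> {1..s}" "a \<notin> S" by blast
      have "\<beta> a = \<beta> n" using exchange[OF S(1,2), of a n] a nS True by auto
      moreover have "\<beta> a \<le> \<beta> j" "\<beta> j \<le> \<beta> n" using j a by (auto intro!: mono)
      ultimately show ?thesis by simp
    qed
  qed
  ultimately show ?thesis by blast
qed

end
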